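(* Let $G$ be an ordered graph that is separable or nested. Then $sat_{<}(n,G)=\Theta(n)$.
   Context: An ordered graph is a finite simple graph whose vertex set is linearly ordered (identified with $[m]$ with the natural order). An ordered graph $H$ contains an ordered graph $G$ if there is an injective order-preserving map $\varphi:V(G)\to V(H)$ with $\varphi(u)\varphi(v)\in E(H)$ for all $uv\in E(G)$; otherwise $H$ avoids $G$. $H$ saturates $G$ if $H$ avoids $G$ but adding any non-edge $xy$ to $H$ yields a graph containing $G$. For $G$ with at least one edge, $sat_{<}(n,G)$ is the minimum number of edges of an ordered graph on $n$ vertices saturating $G$. Edges are written $uv$ with $u<v$. $G$ is separable if its edge set can be partitioned into two non-empty parts $E_1,E_2$ such that for all $u_1v_1\in E_1$ and $u_2v_2\in E_2$ we have $u_1<v_1<u_2<v_2$. $G$ is nested if its edge set can be partitioned into two non-empty parts $E_1,E_2$ such that for all $u_1v_1\in E_1$ and $u_2v_2\in E_2$ we have $u_1<u_2<v_2<v_1$. *)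

theory Defs
  imports Complex_Main "HOL-Library.Landau_Symbols"
begin

text \<open>
  An ordered graph has vertex set \<open>{1..m}\<close>; an undirected edge is represented by the unique
  pair \<open>(u, v)\<close> of its endpoints with \<open>u < v\<close>.
\<close>

datatype ograph = OGraph (num_verts: nat) (edges: "(nat \<times> nat) set")

definition verts :: "ograph \<Rightarrow> nat set" where
  "verts G = {1..num_verts G}"

definition ordered_graph :: "ograph \<Rightarrow> bool" where
  "ordered_graph G \<longleftrightarrow> (\<forall>(u, v) \<in> edges G. u \<in> verts G \<and> v \<in> verts G \<and> u < v)"

definition contains :: "ograph \<Rightarrow> ograph \<Rightarrow> bool" where
  "contains H G \<longleftrightarrow>
     (\<exists>\<phi>. \<phi> ` verts G \<subseteq> verts H \<and> inj_on \<phi> (verts G) \<and> mono_on (verts G) \<phi> \<and>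
          (\<forall>(u, v) \<in> edges G. (\<phi> u, \<phi> v) \<in> edges H))"

abbreviation avoids :: "ograph \<Rightarrow> ograph \<Rightarrow> bool" where
  "avoids H G \<equiv> \<not> contains H G"

definition add_edge :: "ograph \<Rightarrow> nat \<Rightarrow> nat \<Rightarrow> ograph" where
  "add_edge H x y = OGraph (num_verts H) (insert (x, y) (edges H))"

definition saturates :: "ograph \<Rightarrow> ograph \<Rightarrow> bool" where
  "saturates H G \<longleftrightarrow> avoids H G \<and>
     (\<forall>x \<in> verts H. \<forall>y \<in> verts H. x < y \<and> (x, y) \<notin> edges H \<longrightarrow> contains (add_edge H x y) G)"

definition sat_less :: "nat \<Rightarrow> ograph \<Rightarrow> nat" where
  "sat_less n G =
     (LEAST k. \<exists>H. ordered_graph H \<and> num_verts H = n \<and> saturates H G \<and> card (edges H) = k)"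

definition separable :: "ograph \<Rightarrow> bool" where
  "separable G \<longleftrightarrow>
     (\<exists>E1 E2. E1 \<union> E2 = edges G \<and> E1 \<inter> E2 = {} \<and> E1 \<noteq> {} \<and> E2 \<noteq> {} \<and>
        (\<forall>(u1, v1) \<in> E1. \<forall>(u2, v2) \<in> E2. u1 < v1 \<and> v1 < u2 \<and> u2 < v2))"

definition nested :: "ograph \<Rightarrow> bool" where
  "nested G \<longleftrightarrow>
     (\<exists>E1 E2. E1 \<union> E2 = edges G \<and> E1 \<inter> E2 = {} \<and> E1 \<noteq> {} \<and> E2 \<noteq> {} \<and>
        (\<forall>(u1, v1) \<in> E1. \<forall>(u2, v2) \<in> E2. u1 < u2 \<and> u2 < v2 \<and> v2 < v1))"

lemma finite_edges:
  assumes "ordered_graph G"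
  shows "finite (edges G)"
proof (rule finite_subset)
  show "edges G \<subseteq> verts G \<times> verts G"
    using assms by (auto simp: ordered_graph_def)
  show "finite (verts G \<times> verts G)"
    by (simp add: verts_def)
qed

text \<open>
  If \<open>G\<close> has an edge, then the set minimised in \<open>sat_less\<close> is nonempty, so \<open>LEAST\<close> denotes
  a genuine minimum for every \<open>n\<close>.
\<close>

lemma ex_saturating:
  assumes "edges G \<noteq> {}"
  shows "\<exists>H. ordered_graph H \<and> num_verts H = n \<and> saturates H G"
proof -
  let ?P = "\<lambda>H. ordered_graph H \<and> num_verts H = n \<and> avoids H G"
  have P0: "?P (OGraph n {})"
    using assms by (auto simp: ordered_graph_def contains_def)
  have bound: "card (edges H) < Suc (card ({1..n} \<times> {1..n}))" if "?P H" for H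
  proof -
    have "edges H \<subseteq> {1..n} \<times> {1..n}"
      using that by (auto simp: ordered_graph_def verts_def)
    then show ?thesis
      by (simp only: less_Suc_eq_le) (intro card_mono finite_cartesian_product finite_atLeastAtMost)
  qed
  obtain H where H: "?P H" and max: "\<And>K. ?P K \<Longrightarrow> card (edges K) \<le> card (edges H)"
    using ex_has_greatest_nat[of ?P "OGraph n {}" "\<lambda>H. card (edges H)"] P0 bound by blast
  have "contains (add_edge H x y) G"
    if "x \<in> verts H" "y \<in> verts H" "x < y" "(x, y) \<notin> edges H" for x y
  proof (rule ccontr)
    assume "avoids (add_edge H x y) G"
    then have "?P (add_edge H x y)"
      using H that by (auto simp: ordered_graph_def verts_def add_edge_def)
    then have "card (edges (add_edge H x y)) \<le> card (edges H)"
      by (rule max)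
    then show False
      using that finite_edges H by (simp add: add_edge_def)
  qed
  then show ?thesis
    using H by (auto simp: saturates_def)
qed

end

theory Submission imports Defs begin

text \<open>
  Upper bound: let \<open>k + 1\<close> be the largest left endpoint of an edge of \<open>G\<close>. The graph in which
  \<open>1, \<dots>, k\<close> are joined to everything, with no further edges, avoids \<open>G\<close>. In a graph
  containing it and avoiding \<open>G\<close>, no vertex beyond \<open>k\<close> has \<open>num_verts G\<close> neighbours to its
  right, for these could host the vertices of \<open>G\<close> after \<open>k + 1\<close>. Hence every saturated
  extension has linearly many edges.

  Lower bound: a saturated graph on at least two vertices has no isolated vertex \<open>a\<close>. Split \<open>G\<close>
  into two parts supporting \<open>E1\<close> and \<open>E2\<close>; a copy of \<open>G\<close> created by a new edge \<open>xy\<close> uses it for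
  one part, so the other part already embeds. In the separable case the non-edges \<open>1a\<close> and \<open>an\<close>
  give the second part to the right of \<open>a\<close> and the first part to its left, hence a copy of \<open>G\<close>.
  In the nested case let \<open>b\<close> be such that the outer part embeds outside of \<open>[a, b]\<close> but not
  outside of \<open>[a, b + 1]\<close>; the non-edge \<open>a(b + 1)\<close> yields the inner part within \<open>(a, b + 1)\<close>,
  again a copy of \<open>G\<close>.
\<close>

section \<open>Embeddings of vertex subsets\<close>

text \<open>Restricting to a vertex set \<open>W\<close> allows partial copies: only edges with both
  endpoints in \<open>W\<close> have to be preserved.\<close>

definition embedding_on :: "ograph \<Rightarrow> ograph \<Rightarrow> nat set \<Rightarrow> (nat \<Rightarrow> nat) \<Rightarrow> bool" where
  "embedding_on G H W \<phi> \<longleftrightarrow> strict_mono_on W \<phi> \<and> \<phi> ` W \<subseteq> verts H \<and>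
     (\<forall>u\<in>W. \<forall>v\<in>W. (u, v) \<in> edges G \<longrightarrow> (\<phi> u, \<phi> v) \<in> edges H)"

lemma strict_mono_on_iff_inj_mono:
  fixes f :: "'a::linorder \<Rightarrow> 'b::linorder"
  shows "strict_mono_on A f \<longleftrightarrow> inj_on f A \<and> mono_on A f"
proof
  assume "strict_mono_on A f"
  then show "inj_on f A \<and> mono_on A f"
    using strict_mono_on_imp_inj_on strict_mono_on_imp_mono_on by blast
next
  assume *: "inj_on f A \<and> mono_on A f"
  show "strict_mono_on A f"
  proof (rule strict_mono_onI)
    fix r s assume rs: "r \<in> A" "s \<in> A" "r < s"
    then have "f r \<le> f s" "f r \<noteq> f s"
      using * by (auto dest: mono_onD inj_onD)
    then show "f r < f s" by simp
  qed
qed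

lemma contains_iff_embedding_on:
  assumes "ordered_graph G"
  shows "contains H G \<longleftrightarrow> (\<exists>\<phi>. embedding_on G H (verts G) \<phi>)"
proof -
  have "(\<forall>(u, v)\<in>edges G. (\<phi> u, \<phi> v) \<in> edges H) \<longleftrightarrow>
    (\<forall>u\<in>verts G. \<forall>v\<in>verts G. (u, v) \<in> edges G \<longrightarrow> (\<phi> u, \<phi> v) \<in> edges H)" for \<phi>
    using assms by (auto simp: ordered_graph_def)
  then show ?thesis
    unfolding contains_def embedding_on_def strict_mono_on_iff_inj_mono by metis
qed

text \<open>
  The copy of \<open>G\<close> created by a new edge uses it for exactly one edge of \<open>G\<close>, so every vertex set
  missing an endpoint of that edge embeds into the old graph.
\<close>

lemma saturates_new_copy:
  assumes "ordered_graph G" "saturates H G"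
    and "x \<in> verts H" "y \<in> verts H" "x < y" "(x, y) \<notin> edges H"
  obtains \<phi> u v where "(u, v) \<in> edges G" "\<phi> u = x" "\<phi> v = y"
    "strict_mono_on (verts G) \<phi>"
    "\<And>W. W \<subseteq> verts G \<Longrightarrow> \<not> {u, v} \<subseteq> W \<Longrightarrow> embedding_on G H W \<phi>"
proof -
  have "contains (add_edge H x y) G" and avoids: "avoids H G"
    using assms by (auto simp: saturates_def)
  then obtain \<phi> where \<phi>: "embedding_on G (add_edge H x y) (verts G) \<phi>"
    using contains_iff_embedding_on[OF assms(1)] by blast
  \<comment> \<open>As \<open>H\<close> avoids \<open>G\<close>, some edge of \<open>G\<close> is
    not mapped into \<open>H\<close>; its image can only be the new edge.\<close>
  have "\<not> embedding_on G H (verts G) \<phi>"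
    using avoids contains_iff_embedding_on[OF assms(1)] by blast
  then obtain u v where uv: "(u, v) \<in> edges G" "u \<in> verts G" "v \<in> verts G"
      "(\<phi> u, \<phi> v) \<notin> edges H"
    using \<phi> by (auto simp: embedding_on_def add_edge_def verts_def)
  then have xy: "\<phi> u = x" "\<phi> v = y"
    using \<phi> by (auto simp: embedding_on_def add_edge_def)
  have sm: "strict_mono_on (verts G) \<phi>" and ran: "\<phi> ` verts G \<subseteq> verts H"
    using \<phi> by (auto simp: embedding_on_def add_edge_def verts_def)
  have inj: "inj_on \<phi> (verts G)"
    using sm by (rule strict_mono_on_imp_inj_on)
  have emb: "embedding_on G H W \<phi>" if W: "W \<subseteq> verts G" "\<not> {u, v} \<subseteq> W" for W
    unfolding embedding_on_def
  proof (intro conjI ballI impI)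
    show "strict_mono_on W \<phi>"
      using sm W by (auto simp: strict_mono_on_def)
    show "\<phi> ` W \<subseteq> verts H"
      using ran W by blast
    fix u' v' assume e: "u' \<in> W" "v' \<in> W" "(u', v') \<in> edges G"
    then have "(\<phi> u', \<phi> v') \<in> insert (x, y) (edges H)"
      using \<phi> W by (auto simp: embedding_on_def add_edge_def)
    \<comment> \<open>By injectivity only \<open>(u, v)\<close> is mapped to the new edge, and
      \<open>W\<close> misses \<open>u\<close> or \<open>v\<close>.\<close>
    moreover have "\<not> (\<phi> u' = x \<and> \<phi> v' = y)"
      using e uv xy W inj_on_eq_iff[OF inj, of u' u] inj_on_eq_iff[OF inj, of v' v] by auto
    ultimately show "(\<phi> u', \<phi> v') \<in> edges H" by auto
  qed
  show thesis
    by (rule that[OF uv(1) xy sm emb])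
qed

text \<open>No edge of \<open>G\<close> crosses between the parts, so edges are preserved piecewise
  and only monotonicity across the parts must be assumed. The parts need not be intervals: in the
  nested case \<open>W1\<close> surrounds \<open>W2\<close>.\<close>

lemma contains_glue:
  assumes "ordered_graph G"
    and "embedding_on G H W1 \<phi>1" "embedding_on G H W2 \<phi>2"
    and "verts G = W1 \<union> W2" "W1 \<inter> W2 = {}"
    and "\<And>u v. (u, v) \<in> edges G \<Longrightarrow> {u, v} \<subseteq> W1 \<or> {u, v} \<subseteq> W2"
    and "\<And>i j. i \<in> W1 \<Longrightarrow> j \<in> W2 \<Longrightarrow> i < j \<Longrightarrow> \<phi>1 i < \<phi>2 j"
    and "\<And>i j. i \<in> W1 \<Longrightarrow> j \<in> W2 \<Longrightarrow> j < i \<Longrightarrow> \<phi>2 j < \<phi>1 i"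
  shows "contains H G"
proof -
  let ?\<phi> = "\<lambda>w. if w \<in> W1 then \<phi>1 w else \<phi>2 w"
  have "embedding_on G H (verts G) ?\<phi>"
    unfolding embedding_on_def
  proof (intro conjI ballI impI)
    show "strict_mono_on (verts G) ?\<phi>"
      using assms(2-5,7,8) by (auto simp: embedding_on_def strict_mono_on_def)
    show "?\<phi> ` verts G \<subseteq> verts H"
      using assms(2-5) by (auto simp: embedding_on_def)
    fix u v assume "(u, v) \<in> edges G"
    then show "(?\<phi> u, ?\<phi> v) \<in> edges H"
      using assms(2,3,5) assms(6)[of u v] by (auto simp: embedding_on_def)
  qed
  then show ?thesis
    using contains_iff_embedding_on[OF assms(1)] by blast
qed

section \<open>Isolated vertices in saturated graphs\<close>

text \<open>Turns the edge partition into a cut of the vertices: \<open>t\<close> is the largest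
  right endpoint in \<open>E1\<close>. A left endpoint from \<open>E2\<close> lies beyond it, so
  both sides of the cut are nonempty.\<close>

lemma separable_split:
  assumes "ordered_graph G" "separable G"
  obtains t where "t \<in> verts G" "Suc t \<in> verts G"
    "\<And>u v. (u, v) \<in> edges G \<Longrightarrow> v \<le> t \<or> t < u"
proof -
  obtain E1 E2 where E: "E1 \<union> E2 = edges G" "E1 \<noteq> {}" "E2 \<noteq> {}"
    and sep: "\<forall>(u1, v1)\<in>E1. \<forall>(u2, v2)\<in>E2. u1 < v1 \<and> v1 < u2 \<and> u2 < v2"
    using assms(2) unfolding separable_def by (elim exE conjE) (rule that)
  have sep: "v1 < u2" if "(u1, v1) \<in> E1" "(u2, v2) \<in> E2" for u1 v1 u2 v2
    using bspec[OF bspec[OF sep that(1), simplified] that(2)] by simp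
  define t where "t = Max (snd ` E1)"
  have fin: "finite E1"
    using E(1) finite_edges[OF assms(1)] by (metis finite_Un)
  have "t \<in> snd ` E1"
    unfolding t_def using fin E(2) by (intro Max_in) auto
  then obtain u1 where u1: "(u1, t) \<in> E1" by auto
  obtain u2 v2 where e2: "(u2, v2) \<in> E2" using E(3) by auto
  have "t \<in> verts G" "u2 \<in> verts G" "t < u2"
    using u1 e2 E(1) sep[OF u1 e2] assms(1) by (auto simp: ordered_graph_def)
  then have "Suc t \<in> verts G" by (auto simp: verts_def)
  moreover have "v \<le> t \<or> t < u" if "(u, v) \<in> edges G" for u v
  proof (cases "(u, v) \<in> E1")
    case True
    then show ?thesis
      unfolding t_def using fin by (force intro: Max_ge)
  next
    case False
    then show ?thesis using that E(1) sep[OF u1] by blast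
  qed
  ultimately show thesis
    using that \<open>t \<in> verts G\<close> by blast
qed

text \<open>The cuts are the largest left endpoint \<open>s\<close> and the smallest right endpoint
  \<open>t\<close> in \<open>E1\<close>. They may belong to different edges, but every edge of
  \<open>E2\<close> lies strictly between them.\<close>

lemma nested_split:
  assumes "ordered_graph G" "nested G"
  obtains s t where "s \<in> verts G" "t \<in> verts G" "Suc s < t"
    "\<And>u v. (u, v) \<in> edges G \<Longrightarrow> u \<le> s \<and> t \<le> v \<or> s < u \<and> v < t"
proof -
  obtain E1 E2 where E: "E1 \<union> E2 = edges G" "E1 \<noteq> {}" "E2 \<noteq> {}"
    and nest: "\<forall>(u1, v1)\<in>E1. \<forall>(u2, v2)\<in>E2. u1 < u2 \<and> u2 < v2 \<and> v2 < v1"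
    using assms(2) unfolding nested_def by (elim exE conjE) (rule that)
  have nest: "u1 < u2 \<and> u2 < v2 \<and> v2 < v1" if "(u1, v1) \<in> E1" "(u2, v2) \<in> E2" for u1 v1 u2 v2
    using bspec[OF bspec[OF nest that(1), simplified] that(2)] by simp
  define s t where "s = Max (fst ` E1)" and "t = Min (snd ` E1)"
  have fin: "finite E1"
    using E(1) finite_edges[OF assms(1)] by (metis finite_Un)
  have "s \<in> fst ` E1"
    unfolding s_def using fin E(2) by (intro Max_in) auto
  then obtain v1 where v1: "(s, v1) \<in> E1" by auto
  have "t \<in> snd ` E1"
    unfolding t_def using fin E(2) by (intro Min_in) auto
  then obtain u1 where u1: "(u1, t) \<in> E1" by auto
  obtain u2 v2 where e2: "(u2, v2) \<in> E2" using E(3) by auto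
  have "s \<in> verts G" "t \<in> verts G"
    using u1 v1 E(1) assms(1) by (auto simp: ordered_graph_def)
  moreover have "Suc s < t"
    using nest[OF v1 e2] nest[OF u1 e2] by simp
  moreover have "u \<le> s \<and> t \<le> v \<or> s < u \<and> v < t" if "(u, v) \<in> edges G" for u v
  proof (cases "(u, v) \<in> E1")
    case True
    then show ?thesis
      unfolding s_def t_def using fin by (force intro: Max_ge Min_le)
  next
    case False
    then show ?thesis using that E(1) nest[OF u1] nest[OF v1] by blast
  qed
  ultimately show thesis
    using that by blast
qed

lemma separable_saturates_no_isolated:
  assumes G: "ordered_graph G" "separable G" and H: "saturates H G"
    and a: "a \<in> verts H" and n: "num_verts H \<ge> 2"
  shows "\<exists>b. (a, b) \<in> edges H \<or> (b, a) \<in> edges H"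
proof (rule ccontr)
  assume "\<not> ?thesis"
  then have iso: "(a, b) \<notin> edges H" "(b, a) \<notin> edges H" for b
    by auto
  obtain t where t: "t \<in> verts G" "Suc t \<in> verts G"
    "\<And>u v. (u, v) \<in> edges G \<Longrightarrow> v \<le> t \<or> t < u"
    using separable_split[OF G] by metis
  let ?W1 = "{w \<in> verts G. w \<le> t}" and ?W2 = "{w \<in> verts G. t < w}"
  define left where "left x \<longleftrightarrow> (\<exists>\<phi>. embedding_on G H ?W1 \<phi> \<and> \<phi> ` ?W1 \<subseteq> {..<x})" for x
  define right where "right y \<longleftrightarrow> (\<exists>\<phi>. embedding_on G H ?W2 \<phi> \<and> \<phi> ` ?W2 \<subseteq> {y<..})" for y
  \<comment> \<open>The new edge plays an edge on one side of the cut; the other side of that copy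
    avoids it and lies strictly beyond its endpoint.\<close>
  have dich: "left x \<or> right y"
    if xy: "x \<in> verts H" "y \<in> verts H" "x < y" "(x, y) \<notin> edges H" for x y
  proof -
    obtain \<phi> u v where \<phi>: "(u, v) \<in> edges G" "\<phi> u = x" "\<phi> v = y"
      "strict_mono_on (verts G) \<phi>"
      "\<And>W. W \<subseteq> verts G \<Longrightarrow> \<not> {u, v} \<subseteq> W \<Longrightarrow> embedding_on G H W \<phi>"
      using saturates_new_copy[OF G(1) H xy] by metis
    have uv: "u \<in> verts G" "v \<in> verts G" "u < v"
      using \<phi>(1) G(1) by (auto simp: ordered_graph_def)
    show ?thesis
    proof (cases "v \<le> t")
      case True
      then have "\<phi> ` ?W2 \<subseteq> {y<..}"
        using \<phi>(3,4) uv by (auto intro: strict_mono_onD[of "verts G" \<phi> v])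
      moreover have "embedding_on G H ?W2 \<phi>"
        using True by (intro \<phi>(5)) auto
      ultimately show ?thesis unfolding right_def by blast
    next
      case False
      then have "t < u" using t(3)[OF \<phi>(1)] by simp
      then have "\<phi> ` ?W1 \<subseteq> {..<x}"
        using \<phi>(2,4) uv by (auto intro: strict_mono_onD[of "verts G" \<phi> _ u])
      moreover have "embedding_on G H ?W1 \<phi>"
        using \<open>t < u\<close> by (intro \<phi>(5)) auto
      ultimately show ?thesis unfolding left_def by blast
    qed
  qed
  have "t \<in> ?W1" "Suc t \<in> ?W2"
    using t(1,2) by auto
  moreover have "\<phi> w \<in> {1..num_verts H}" if "embedding_on G H W \<phi>" "w \<in> W" for \<phi> w W
    using that by (auto simp: embedding_on_def verts_def)
  \<comment> \<open>Both parts have a vertex, and there is no room before vertex 1 or after the last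
    one.\<close>
  ultimately have ends: "\<not> left 1" "\<not> right (num_verts H)"
    unfolding left_def right_def image_subset_iff
    by (meson atLeastAtMost_iff greaterThan_iff lessThan_iff not_le)+
  have V: "1 \<in> verts H" "num_verts H \<in> verts H" "1 \<le> a" "a \<le> num_verts H"
    using a n by (auto simp: verts_def)
  \<comment> \<open>If the isolated \<open>a\<close> were the first or last vertex, the pair of
    extreme vertices would be a non-edge, contradicting \<open>dich\<close> and
    \<open>ends\<close>.\<close>
  have "a \<noteq> 1"
    using dich[of 1 "num_verts H"] V n ends iso by auto
  moreover have "a \<noteq> num_verts H"
    using dich[of 1 "num_verts H"] V n ends iso by auto
  ultimately have "left a" "right a"
    using dich[of 1 a] dich[of a "num_verts H"] V a ends iso by auto
  then obtain \<phi>1 \<phi>2 where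
    "embedding_on G H ?W1 \<phi>1" "\<phi>1 ` ?W1 \<subseteq> {..<a}"
    "embedding_on G H ?W2 \<phi>2" "\<phi>2 ` ?W2 \<subseteq> {a<..}"
    unfolding left_def right_def by blast
  moreover have "{u, v} \<subseteq> ?W1 \<or> {u, v} \<subseteq> ?W2" if "(u, v) \<in> edges G" for u v
    using t(3)[OF that] that G(1) by (fastforce simp: ordered_graph_def)
  ultimately have "contains H G"
    by (intro contains_glue[OF G(1), of H ?W1 \<phi>1 ?W2 \<phi>2])
       (auto simp: image_subset_iff intro: less_trans)
  then show False
    using H by (simp add: saturates_def)
qed

lemma nested_saturates_no_isolated:
  assumes G: "ordered_graph G" "nested G" and H: "saturates H G"
    and a: "a \<in> verts H" and n: "num_verts H \<ge> 2"
  shows "\<exists>b. (a, b) \<in> edges H \<or> (b, a) \<in> edges H"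
proof (rule ccontr)
  assume "\<not> ?thesis"
  then have iso: "(a, b) \<notin> edges H" "(b, a) \<notin> edges H" for b
    by auto
  obtain s t where st: "s \<in> verts G" "t \<in> verts G" "Suc s < t"
    "\<And>u v. (u, v) \<in> edges G \<Longrightarrow> u \<le> s \<and> t \<le> v \<or> s < u \<and> v < t"
    using nested_split[OF G] by metis
  let ?W1 = "{w \<in> verts G. w \<le> s \<or> t \<le> w}" and ?W2 = "{w \<in> verts G. s < w \<and> w < t}"
  define outer where "outer x y \<longleftrightarrow> (\<exists>\<phi>. embedding_on G H ?W1 \<phi> \<and>
    (\<forall>w\<in>?W1. (w \<le> s \<longrightarrow> \<phi> w < x) \<and> (t \<le> w \<longrightarrow> y < \<phi> w)))" for x y
  define inner where "inner x y \<longleftrightarrow> (\<exists>\<phi>. embedding_on G H ?W2 \<phi> \<and>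
    (\<forall>w\<in>?W2. x < \<phi> w \<and> \<phi> w < y))" for x y
  \<comment> \<open>If the new edge plays an outer edge, the inner part sits strictly inside it;
    otherwise the outer part sits strictly outside it.\<close>
  have dich: "outer x y \<or> inner x y"
    if xy: "x \<in> verts H" "y \<in> verts H" "x < y" "(x, y) \<notin> edges H" for x y
  proof -
    obtain \<phi> u v where \<phi>: "(u, v) \<in> edges G" "\<phi> u = x" "\<phi> v = y"
      "strict_mono_on (verts G) \<phi>"
      "\<And>W. W \<subseteq> verts G \<Longrightarrow> \<not> {u, v} \<subseteq> W \<Longrightarrow> embedding_on G H W \<phi>"
      using saturates_new_copy[OF G(1) H xy] by metis
    have uv: "u \<in> verts G" "v \<in> verts G" "u < v"
      using \<phi>(1) G(1) by (auto simp: ordered_graph_def)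
    note mono = strict_mono_onD[OF \<phi>(4)]
    show ?thesis
    proof (cases "u \<le> s")
      case True
      then have "t \<le> v" using st(4)[OF \<phi>(1)] by simp
      then have "\<forall>w\<in>?W2. x < \<phi> w \<and> \<phi> w < y"
        using True mono[of u] mono[of _ v] uv \<phi>(2,3) by auto
      moreover have "embedding_on G H ?W2 \<phi>"
        using True by (intro \<phi>(5)) auto
      ultimately show ?thesis unfolding inner_def by blast
    next
      case False
      then have "s < u" "v < t" using st(4)[OF \<phi>(1)] by auto
      then have "\<forall>w\<in>?W1. (w \<le> s \<longrightarrow> \<phi> w < x) \<and> (t \<le> w \<longrightarrow> y < \<phi> w)"
        using mono[of _ u] mono[of v] uv \<phi>(2,3) by auto
      moreover have "embedding_on G H ?W1 \<phi>"
        using \<open>s < u\<close> \<open>v < t\<close> uv by (intro \<phi>(5)) auto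
      ultimately show ?thesis unfolding outer_def by blast
    qed
  qed
  have "Suc s \<in> ?W2"
    using st(1-3) by (auto simp: verts_def)
  \<comment> \<open>The inner part has at least one vertex, which does not fit between consecutive
    integers.\<close>
  then have no_inner: "\<not> inner x (Suc x)" for x
    unfolding inner_def by fastforce
  have no_outer: "\<not> outer x (num_verts H)" for x
  proof
    assume "outer x (num_verts H)"
    then obtain \<phi> where "embedding_on G H ?W1 \<phi>" "num_verts H < \<phi> t"
      using st(2) unfolding outer_def by blast
    moreover have "t \<in> ?W1" using st(2) by simp
    ultimately show False
      by (auto simp: embedding_on_def verts_def)
  qed
  have V: "1 \<le> a" "a \<le> num_verts H"
    using a by (auto simp: verts_def)
  \<comment> \<open>Otherwise the non-edge from \<open>a - 1\<close> to \<open>a\<close> leaves no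
    room inside it, nor to its right.\<close>
  have "a \<noteq> num_verts H"
  proof
    assume last: "a = num_verts H"
    define c where "c = a - 1"
    have c: "a = Suc c" "1 \<le> c"
      using n last by (auto simp: c_def)
    then have "c \<in> verts H"
      using a by (auto simp: verts_def)
    then show False
      using dich[of c a] c(1) a iso no_inner[of c] no_outer[of c] last by auto
  qed
  then have "Suc a \<le> num_verts H" using V by simp
  then have "outer a (Suc a)"
    using dich[of a "Suc a"] a iso no_inner by (auto simp: verts_def)
  \<comment> \<open>\<open>outer a\<close> holds at \<open>Suc a\<close> and fails at the last
    vertex, so it changes from true to false at some step.\<close>
  have "\<exists>b\<ge>Suc a. b < num_verts H \<and> outer a b \<and> \<not> outer a (Suc b)"
  proof (rule ccontr)
    assume *: "\<not> ?thesis"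
    have "outer a k" if "Suc a \<le> k" "k \<le> num_verts H" for k
      using that
    proof (induction k rule: dec_induct)
      case base
      show ?case by fact
    next
      case (step k)
      then show ?case using * by simp
    qed
    then have "outer a (num_verts H)"
      using \<open>Suc a \<le> num_verts H\<close> by blast
    then show False using no_outer by blast
  qed
  then obtain b where b: "Suc a \<le> b" "b < num_verts H" "outer a b" "\<not> outer a (Suc b)"
    by blast
  \<comment> \<open>Lying below \<open>Suc b\<close> means lying at most at \<open>b\<close>, while
    the outer part for \<open>b\<close> uses only vertices below \<open>a\<close> or above
    \<open>b\<close>; hence the two parts interleave correctly.\<close>
  have "inner a (Suc b)"
    using dich[of a "Suc b"] b V iso a by (auto simp: verts_def)
  then obtain \<phi>2 where \<phi>2: "embedding_on G H ?W2 \<phi>2" "\<And>w. w \<in> ?W2 \<Longrightarrow> a < \<phi>2 w \<and> \<phi>2 w \<le> b"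
    unfolding inner_def by (auto simp: less_Suc_eq_le)
  obtain \<phi>1 where \<phi>1: "embedding_on G H ?W1 \<phi>1"
    "\<And>w. w \<in> ?W1 \<Longrightarrow> (w \<le> s \<longrightarrow> \<phi>1 w < a) \<and> (t \<le> w \<longrightarrow> b < \<phi>1 w)"
    using b(3) unfolding outer_def by blast
  have "contains H G"
  proof (rule contains_glue[OF G(1) \<phi>1(1) \<phi>2(1)])
    show "{u, v} \<subseteq> ?W1 \<or> {u, v} \<subseteq> ?W2" if "(u, v) \<in> edges G" for u v
      using st(4)[OF that] that G(1) by (fastforce simp: ordered_graph_def)
    show "\<phi>1 i < \<phi>2 j" if "i \<in> ?W1" "j \<in> ?W2" "i < j" for i j
      using \<phi>1(2)[OF that(1)] \<phi>2(2)[OF that(2)] that by auto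
    show "\<phi>2 j < \<phi>1 i" if "i \<in> ?W1" "j \<in> ?W2" "j < i" for i j
      using \<phi>1(2)[OF that(1)] \<phi>2(2)[OF that(2)] that by auto
  qed auto
  then show False
    using H by (simp add: saturates_def)
qed

text \<open>Every vertex is an endpoint, and each edge has only two.\<close>

lemma card_edges_ge_no_isolated:
  assumes "ordered_graph H" "\<And>a. a \<in> verts H \<Longrightarrow> \<exists>b. (a, b) \<in> edges H \<or> (b, a) \<in> edges H"
  shows "num_verts H \<le> 2 * card (edges H)"
proof -
  have fin: "finite (edges H)"
    using assms(1) by (rule finite_edges)
  have "verts H \<subseteq> fst ` edges H \<union> snd ` edges H"
    using assms(2) by force
  then have "card (verts H) \<le> card (fst ` edges H \<union> snd ` edges H)"
    using fin by (intro card_mono) auto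
  also have "\<dots> \<le> card (fst ` edges H) + card (snd ` edges H)"
    by (rule card_Un_le)
  also have "\<dots> \<le> 2 * card (edges H)"
    using card_image_le[OF fin, of fst] card_image_le[OF fin, of snd] by simp
  finally show ?thesis by (simp add: verts_def)
qed

section \<open>The saturation number\<close>

lemma sat_less_attained:
  assumes "edges G \<noteq> {}"
  obtains H where "ordered_graph H" "num_verts H = n" "saturates H G"
    "card (edges H) = sat_less n G"
proof -
  have "\<exists>k H. ordered_graph H \<and> num_verts H = n \<and> saturates H G \<and> card (edges H) = k"
    using ex_saturating[OF assms] by blast
  then have "\<exists>H. ordered_graph H \<and> num_verts H = n \<and> saturates H G \<and> card (edges H) = sat_less n G"
    unfolding sat_less_def by (rule LeastI_ex)
  then show thesis
    using that by blast
qed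

lemma sat_less_le:
  assumes "ordered_graph H" "num_verts H = n" "saturates H G"
  shows "sat_less n G \<le> card (edges H)"
  unfolding sat_less_def using assms by (intro Least_le) blast

section \<open>Linear lower bound\<close>

lemma sat_less_lower:
  assumes "ordered_graph G" "separable G \<or> nested G" "2 \<le> n"
  shows "n \<le> 2 * sat_less n G"
proof -
  have "edges G \<noteq> {}"
    using assms(2) by (auto simp: separable_def nested_def)
  then obtain H where H: "ordered_graph H" "num_verts H = n" "saturates H G"
    "card (edges H) = sat_less n G"
    by (rule sat_less_attained)
  have "num_verts H \<le> 2 * card (edges H)"
  proof (rule card_edges_ge_no_isolated[OF H(1)])
    fix a assume "a \<in> verts H"
    then show "\<exists>b. (a, b) \<in> edges H \<or> (b, a) \<in> edges H"
      using separable_saturates_no_isolated[OF assms(1) _ H(3)]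
        nested_saturates_no_isolated[OF assms(1) _ H(3)] assms(2,3) H(2) by blast
  qed
  then show ?thesis using H by simp
qed

section \<open>Linear upper bound\<close>

text \<open>An avoiding supergraph of \<open>H0\<close> on the same vertices with the most edges is
  saturated, since an edge that could be added without creating \<open>G\<close> would contradict
  maximality.\<close>

lemma saturated_extension:
  assumes "ordered_graph H0" "avoids H0 G"
  obtains H where "ordered_graph H" "num_verts H = num_verts H0" "edges H0 \<subseteq> edges H"
    "saturates H G"
proof -
  let ?P = "\<lambda>H. ordered_graph H \<and> num_verts H = num_verts H0 \<and> edges H0 \<subseteq> edges H \<and> avoids H G"
  let ?V = "verts H0 \<times> verts H0"
  have bound: "card (edges H) < Suc (card ?V)" if "?P H" for H
  proof -
    have "edges H \<subseteq> ?V"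
      using that by (auto simp: ordered_graph_def verts_def)
    moreover have "finite ?V"
      by (simp add: verts_def)
    ultimately have "card (edges H) \<le> card ?V"
      by (intro card_mono)
    then show ?thesis by simp
  qed
  obtain H where H: "?P H" and max: "\<And>K. ?P K \<Longrightarrow> card (edges K) \<le> card (edges H)"
    using ex_has_greatest_nat[of ?P H0 "\<lambda>H. card (edges H)"] assms bound by blast
  have "contains (add_edge H x y) G"
    if "x \<in> verts H" "y \<in> verts H" "x < y" "(x, y) \<notin> edges H" for x y
  proof (rule ccontr)
    assume "avoids (add_edge H x y) G"
    then have "?P (add_edge H x y)"
      using H that by (auto simp: ordered_graph_def verts_def add_edge_def)
    then have "card (edges (add_edge H x y)) \<le> card (edges H)"
      by (rule max)
    then show False
      using that finite_edges H by (simp add: add_edge_def)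
  qed
  then show thesis
    using H that by (auto simp: saturates_def)
qed

text \<open>Used to show that no copy of \<open>G\<close> can place vertex \<open>c\<close> before
  position \<open>c\<close>.\<close>

lemma strict_mono_on_ge_id:
  fixes f :: "nat \<Rightarrow> nat"
  assumes "strict_mono_on {1..m} f" "\<And>i. i \<in> {1..m} \<Longrightarrow> 1 \<le> f i" "i \<in> {1..m}"
  shows "i \<le> f i"
  using assms(3)
proof (induction i)
  case (Suc i)
  show ?case
  proof (cases "i = 0")
    case True
    then show ?thesis using assms(2) Suc.prems by auto
  next
    case False
    then have "i \<le> f i" "f i < f (Suc i)"
      using Suc strict_mono_onD[OF assms(1), of i "Suc i"] by auto
    then show ?thesis by simp
  qed
qed simp

lemma card_eq_sum_out_degrees:
  assumes "finite V" "E \<subseteq> V \<times> UNIV" "\<And>x. x \<in> V \<Longrightarrow> finite (E `` {x})"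
  shows "card E = (\<Sum>x\<in>V. card (E `` {x}))"
proof -
  have "E = Sigma V (\<lambda>x. E `` {x})"
    using assms(2) by auto
  then show ?thesis
    using card_SigmaI[of V "\<lambda>x. E `` {x}"] assms by simp
qed

lemma sat_less_upper:
  assumes G: "ordered_graph G" "edges G \<noteq> {}"
  shows "sat_less n G \<le> 2 * num_verts G * n"
proof -
  define m where "m = num_verts G"
  \<comment> \<open>This is the \<open>k + 1\<close> of the overview.\<close>
  define c where "c = Max (fst ` edges G)"
  have fin: "finite (edges G)"
    using G(1) by (rule finite_edges)
  have "c \<in> fst ` edges G"
    unfolding c_def using fin G(2) by (intro Max_in) auto
  then obtain d where cd: "(c, d) \<in> edges G" by auto
  then have c: "1 \<le> c" "c < d" "d \<le> m"
    using G(1) by (auto simp: ordered_graph_def verts_def m_def)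
  have c_max: "u \<le> c" if "(u, v) \<in> edges G" for u v
    unfolding c_def using fin that by (force intro: Max_ge)
  define H0 where "H0 = OGraph n {(x, y). 1 \<le> x \<and> x < c \<and> x < y \<and> y \<le> n}"
  have "ordered_graph H0"
    by (auto simp: ordered_graph_def H0_def verts_def)
  moreover have "avoids H0 G"
  proof
    assume "contains H0 G"
    then obtain \<phi> where \<phi>: "embedding_on G H0 (verts G) \<phi>"
      using contains_iff_embedding_on[OF G(1)] by blast
    \<comment> \<open>The image of \<open>(c, d)\<close> would then have left endpoint at least
      \<open>c\<close>, but every edge of \<open>H0\<close> starts before \<open>c\<close>.\<close>
    have "c \<le> \<phi> c"
    proof (rule strict_mono_on_ge_id)
      show "strict_mono_on {1..m} \<phi>"
        using \<phi> by (simp add: embedding_on_def verts_def m_def)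
      show "1 \<le> \<phi> i" if "i \<in> {1..m}" for i
        using \<phi> that by (force simp: embedding_on_def verts_def m_def image_subset_iff)
    qed (use c in auto)
    moreover have "(\<phi> c, \<phi> d) \<in> edges H0"
      using \<phi> cd G(1) by (auto simp: embedding_on_def ordered_graph_def)
    ultimately show False by (simp add: H0_def)
  qed
  ultimately obtain H where H: "ordered_graph H" "num_verts H = num_verts H0"
    "edges H0 \<subseteq> edges H" "saturates H G"
    by (rule saturated_extension)
  have n: "num_verts H = n" "verts H = {1..n}"
    using H(2) by (auto simp: H0_def verts_def)
  let ?N = "\<lambda>x. edges H `` {x}"
  have sub: "?N x \<subseteq> {1..n}" and right: "y \<in> ?N x \<Longrightarrow> x < y" for x y
    using H(1) n by (auto simp: ordered_graph_def)
  have finN: "finite (?N x)" for x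
    using sub by (rule finite_subset) simp
  have deg: "card (?N x) \<le> m" if x: "c \<le> x" "x \<le> n" for x
  proof (rule ccontr)
    assume "\<not> ?thesis"
    then have big: "m < card (?N x)" by simp
    define ys where "ys = sorted_list_of_set (?N x)"
    have ys: "sorted_wrt (<) ys" "set ys = ?N x" "m < length ys"
      using finN big by (auto simp: ys_def)
    \<comment> \<open>Vertices after \<open>c\<close> go to right neighbours of \<open>x\<close>.
      The list is indexed from 0 and has more than \<open>m\<close> entries, so
      \<open>ys ! i\<close> exists for all \<open>i\<close> up to \<open>m\<close>; skipping its
      first entries is harmless.\<close>
    define \<phi> where "\<phi> i = (if i < c then i else if i = c then x else ys ! i)" for i
    have nbr: "ys ! i \<in> ?N x" if "i \<le> m" for i
      using ys that by (metis nth_mem le_less_trans)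
    have "embedding_on G H (verts G) \<phi>"
      unfolding embedding_on_def
    proof (intro conjI ballI impI)
      show "strict_mono_on (verts G) \<phi>"
      proof (rule strict_mono_onI)
        fix i j assume ij: "i \<in> verts G" "j \<in> verts G" "i < j"
        then have "i \<le> m" "j \<le> m" by (auto simp: verts_def m_def)
        then have "x < ys ! j" "ys ! i < ys ! j"
          using right nbr ys ij(3) by (auto simp: sorted_wrt_iff_nth_less)
        then show "\<phi> i < \<phi> j"
          using ij(3) x by (auto simp: \<phi>_def)
      qed
      show "\<phi> ` verts G \<subseteq> verts H"
        using nbr sub x c by (fastforce simp: \<phi>_def verts_def m_def n)
      fix u v assume uv: "u \<in> verts G" "v \<in> verts G" "(u, v) \<in> edges G"
      then have le: "1 \<le> u" "u \<le> c" "u < v" "v \<le> m"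
        using c_max G(1) by (auto simp: ordered_graph_def verts_def m_def)
      show "(\<phi> u, \<phi> v) \<in> edges H"
      \<comment> \<open>Edges starting at \<open>c\<close> use the neighbours of \<open>x\<close>;
        all others start before \<open>c\<close> and are already present in
        \<open>H0\<close>.\<close>
      proof (cases "u = c")
        case True
        then show ?thesis using le nbr[of v] by (simp add: \<phi>_def)
      next
        case False
        have "u < \<phi> v" "\<phi> v \<le> n"
          using False le x right[OF nbr[of v]] sub[of x] nbr[of v] by (auto simp: \<phi>_def)
        then have "(u, \<phi> v) \<in> edges H0"
          using False le by (simp add: H0_def)
        then show ?thesis
          using False le H(3) by (auto simp: \<phi>_def)
      qed
    qed
    then show False
      using contains_iff_embedding_on[OF G(1)] H(4) by (auto simp: saturates_def)
  qed
  have "card (edges H) = (\<Sum>x\<in>{1..n}. card (?N x))"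
    using H(1) n finN by (intro card_eq_sum_out_degrees) (auto simp: ordered_graph_def)
  \<comment> \<open>The fewer than \<open>c\<close> vertices before \<open>c\<close> get the trivial
    bound \<open>n\<close>; all others have right degree at most \<open>m\<close> by
    \<open>deg\<close>.\<close>
  also have "\<dots> \<le> (\<Sum>x\<in>{1..n}. m + (if x \<in> {..<c} then n else 0))"
  proof (rule sum_mono)
    fix x assume "x \<in> {1..n}"
    moreover have "card (?N x) \<le> n"
      using card_mono[OF _ sub[of x]] by simp
    ultimately show "card (?N x) \<le> m + (if x \<in> {..<c} then n else 0)"
      using deg[of x] by auto
  qed
  also have "\<dots> = n * m + card ({1..n} \<inter> {..<c}) * n"
    by (simp add: sum.distrib sum.inter_restrict[symmetric] del: lessThan_iff)
  also have "card ({1..n} \<inter> {..<c}) \<le> card {..<c}"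
    by (intro card_mono) auto
  also have "n * m + card {..<c} * n \<le> n * m + m * n"
    using c by simp
  finally have "card (edges H) \<le> 2 * m * n"
    by (simp add: algebra_simps)
  then show ?thesis
    using sat_less_le[OF H(1) n(1) H(4)] by (simp add: m_def)
qed

theorem theorem2:
  fixes G :: ograph
  assumes "ordered_graph G"
    and "separable G \<or> nested G"
  shows "(\<lambda>n. real (sat_less n G)) \<in> \<Theta>(\<lambda>n. real n)"
proof (rule bigthetaI)
  have "edges G \<noteq> {}"
    using assms(2) by (auto simp: separable_def nested_def)
  note upper = sat_less_upper[OF assms(1) this]
  have "real (sat_less n G) \<le> real (2 * num_verts G) * real n" for n
    using upper[of n] by (metis of_nat_le_iff of_nat_mult)
  then show "(\<lambda>n. real (sat_less n G)) \<in> O(\<lambda>n. real n)"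
    by (intro bigoI[of _ "real (2 * num_verts G)"]) simp
  \<comment> \<open>Only an eventual bound is required, so \<open>n\<close> may be taken to be at
    least 2.\<close>
  have "(1 / 2) * real n \<le> real (sat_less n G)" if "2 \<le> n" for n
    using sat_less_lower[OF assms that] by linarith
  then show "(\<lambda>n. real (sat_less n G)) \<in> \<Omega>(\<lambda>n. real n)"
    by (intro landau_omega.bigI[of "1 / 2"])
       (auto simp: eventually_at_top_linorder intro!: exI[of _ 2])
qed

end
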